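(* Let $n \ge 2$ and let $P_n(x) = x^n + a x^{n-1} + b x^{n-2} + \sum_{k=0}^{n-3} c_k x^k$ be a polynomial with complex coefficients. Let $\theta \in \mathbb{R}$ and, for $h > 0$, let $$D_n(x,\theta,h) = \frac{e^{i\theta} P_n(x+ih) - e^{-i\theta} P_n(x-ih)}{i}.$$ Let $N = n$ if $\sin\theta \neq 0$ and $N = n-1$ if $\sin\theta = 0$, and let $X_1(h,\theta), \dots, X_N(h,\theta)$ be the roots of the polynomial $D_n(\cdot,\theta,h)$, numbered so that $\operatorname{Re} X_1(h,\theta) \le \operatorname{Re} X_2(h,\theta) \le \dots \le \operatorname{Re} X_N(h,\theta)$. Let $x_1 < x_2 < \dots < x_N$ be the zeros of $Q_n(x,\theta)$, where $Q_k(x,\theta) = \frac{1}{i}\left(e^{i\theta}(x+i)^k - e^{-i\theta}(x-i)^k\right)$ for $k\ge 0$. Then for every $j = 1, \dots, N$, $$X_j(h,\theta) = x_j \cdot h - \frac{a}{n} + \left(\frac{a^2(n-1)}{2n^2} - \frac{b}{n}\right) \frac{Q_{n-2}(x_j,\theta)}{Q_{n-1}(x_j,\theta)} \cdot \frac{1}{h} + O\left(\frac{1}{h^2}\right), \qquad h \to \infty.$$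
   Context: The polynomial $P_n$ and the number $\theta$ are fixed as $h \to \infty$ (the constant in $O(\cdot)$ may depend on them). The polynomial $D_n(\cdot,\theta,h)$ has exactly $N$ roots counted with multiplicity. The polynomial $Q_n(x,\theta)$ has exactly $N$ zeros, all real and simple: they are the numbers $\cot\frac{-\theta+\pi k}{n}$, $k = 1,\dots,n$, if $\sin\theta \neq 0$, and $\cot\frac{\pi k}{n}$, $k = 1, \dots, n-1$, if $\sin\theta = 0$. *)

theory Defs
  imports
    "HOL-Analysis.Analysis"
    "HOL-Computational_Algebra.Computational_Algebra"
    "HOL-Library.Landau_Symbols"
begin

definition P_poly :: "nat \<Rightarrow> complex \<Rightarrow> complex \<Rightarrow> (nat \<Rightarrow> complex) \<Rightarrow> complex poly" where
  "P_poly n a b c = monom 1 n + monom a (n - 1) + monom b (n - 2) + (\<Sum>k<n - 2. monom (c k) k)"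

text \<open>
  \<^term>\<open>D_poly\<close> is the polynomial in \<open>x\<close> with values
  \<open>(e\<^sup>i\<^sup>\<theta> P(x + ih) - e\<^sup>-\<^sup>i\<^sup>\<theta> P(x - ih)) / i\<close>
  (lemma \<open>poly_D_poly\<close>). It is a \<^typ>\<open>complex poly\<close> rather than a function so that its roots
  can be counted with multiplicity.
\<close>
definition D_poly :: "complex poly \<Rightarrow> real \<Rightarrow> real \<Rightarrow> complex poly" where
  "D_poly P \<theta> h = smult (1 / \<i>)
     (smult (exp (\<i> * of_real \<theta>)) (pcompose P [:\<i> * of_real h, 1:])
      - smult (exp (- (\<i> * of_real \<theta>))) (pcompose P [:- (\<i> * of_real h), 1:]))"

lemma poly_D_poly:
  "poly (D_poly P \<theta> h) x =
     (exp (\<i> * of_real \<theta>) * poly P (x + \<i> * of_real h)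
      - exp (- (\<i> * of_real \<theta>)) * poly P (x - \<i> * of_real h)) / \<i>"
  by (simp add: D_poly_def poly_pcompose add.commute)

definition Q :: "nat \<Rightarrow> real \<Rightarrow> complex \<Rightarrow> complex" where
  "Q k \<theta> x = 1 / \<i> *
     (exp (\<i> * of_real \<theta>) * (x + \<i>) ^ k - exp (- (\<i> * of_real \<theta>)) * (x - \<i>) ^ k)"

end

theory Submission
  imports Defs
begin

text \<open>
  With \<open>x = h y\<close> and \<open>\<epsilon> = 1 / h\<close>, the polynomial \<open>h\<^sup>-\<^sup>n D\<^sub>n(h y, \<theta>, h)\<close> becomes
  \<open>F(\<epsilon>, y) = Q\<^sub>n(y) + a \<epsilon> Q\<^sub>n\<^sub>-\<^sub>1(y) + b \<epsilon>\<^sup>2 Q\<^sub>n\<^sub>-\<^sub>2(y) + O(\<epsilon>\<^sup>3)\<close>, and it equals \<open>L\<close> times the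
  product of the factors \<open>y - X\<^sub>i / h\<close> with \<open>L \<noteq> 0\<close> independent of \<open>h\<close>. At each \<open>x\<^sub>i\<close> the product
  tends to 0, so some root is close to \<open>x\<^sub>i\<close>; since the \<open>x\<^sub>i\<close> are separated and the roots are ordered
  by real part, that root is the \<open>i\<close>-th one. At the approximate root
  \<open>z = x\<^sub>j + \<alpha> \<epsilon> + \<beta> \<epsilon>\<^sup>2\<close> the product is \<open>O(\<epsilon>\<^sup>3)\<close> while all factors but the \<open>j\<close>-th stay away from 0,
  hence \<open>X\<^sub>j / h - z = O(\<epsilon>\<^sup>3)\<close>.
\<close>

section \<open>Localizing ordered roots\<close>

text \<open>A strictly increasing map on naturals rises by at least 1 per step. Counting up from
  \<open>f 1 \<ge> 1\<close> gives \<open>f j \<ge> j\<close>, and counting up to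
  \<open>f N \<le> N\<close> gives \<open>f j \<le> j\<close>.\<close>

lemma strict_mono_on_interval_eq_id:
  fixes f :: "nat \<Rightarrow> nat"
  assumes "strict_mono_on {1..N} f" and "f ` {1..N} \<subseteq> {1..N}" and "j \<in> {1..N}"
  shows "f j = j"
proof -
  have shift: "f k + i \<le> f (k + i)" if "1 \<le> k" "k + i \<le> N" for k i
    using that
  proof (induction i)
    case (Suc i)
    have "f (k + i) < f (k + Suc i)"
      using Suc.prems by (intro strict_mono_onD[OF assms(1)]) auto
    then show ?case using Suc by simp
  qed simp
  have "1 \<in> {1..N}" "N \<in> {1..N}" using assms(3) by auto
  then have "f 1 \<in> {1..N}" "f N \<in> {1..N}" using assms(2) by blast+
  then show ?thesis
    using shift[of 1 "j - 1"] shift[of j "N - j"] assms(3) by auto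
qed

lemma prod_less_power_imp_ex_less:
  fixes f :: "'a \<Rightarrow> real"
  assumes "prod f A < d ^ card A" and "0 \<le> d"
  shows "\<exists>i\<in>A. f i < d"
proof (rule ccontr)
  assume "\<not> ?thesis"
  then have "(\<Prod>i\<in>A. d) \<le> prod f A"
    using assms(2) by (intro prod_mono) auto
  then show False using assms(1) by simp
qed

text \<open>Pick for each \<open>x k\<close> the index \<open>f k\<close> of some nearby point. Real
  parts move by less than \<open>d\<close> at either end of a gap of at least \<open>2 * d\<close>,
  so the ordering of the real parts forces \<open>f\<close> to be strictly increasing, hence the
  identity.\<close>

lemma ordered_points_close:
  fixes x :: "nat \<Rightarrow> real" and Y :: "nat \<Rightarrow> complex"
  assumes gap: "\<And>i k. i \<in> {1..N} \<Longrightarrow> k \<in> {1..N} \<Longrightarrow> i < k \<Longrightarrow> x i + 2 * d \<le> x k"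
    and mono: "mono_on {1..N} (\<lambda>i. Re (Y i))"
    and near: "\<And>k. k \<in> {1..N} \<Longrightarrow> \<exists>i\<in>{1..N}. norm (of_real (x k) - Y i) < d"
    and j: "j \<in> {1..N}"
  shows "norm (of_real (x j) - Y j) < d"
proof -
  obtain f where f: "\<And>k. k \<in> {1..N} \<Longrightarrow> f k \<in> {1..N} \<and> norm (of_real (x k) - Y (f k)) < d"
    using near by metis
  have re: "\<bar>x k - Re (Y (f k))\<bar> < d" if "k \<in> {1..N}" for k
    using f[OF that] abs_Re_le_cmod[of "of_real (x k) - Y (f k)"] by simp
  have "strict_mono_on {1..N} f"
  proof (rule strict_mono_onI)
    fix i k assume ik: "i \<in> {1..N}" "k \<in> {1..N}" "i < k"
    have "Re (Y (f i)) < Re (Y (f k))"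
      using re[OF ik(1)] re[OF ik(2)] gap[OF ik] by linarith
    then show "f i < f k"
      using mono_onD[OF mono, of "f k" "f i"] f ik by (meson not_le)
  qed
  then have "f j = j"
    using f j by (intro strict_mono_on_interval_eq_id) auto
  then show ?thesis using f[OF j] by simp
qed

lemma finite_strict_mono_gap:
  fixes x :: "nat \<Rightarrow> real"
  assumes "strict_mono_on {1..N} x"
  obtains d where "d > 0"
    "\<And>i k. i \<in> {1..N} \<Longrightarrow> k \<in> {1..N} \<Longrightarrow> i < k \<Longrightarrow> x i + d \<le> x k"
proof -
  \<comment> \<open>The extra element 1 keeps the set nonempty when there is no pair
    \<open>i < k\<close>.\<close>
  define S where "S = insert 1 ((\<lambda>(i, k). x k - x i) ` {(i, k). i \<in> {1..N} \<and> k \<in> {1..N} \<and> i < k})"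
  have "finite {(i, k). i \<in> {1..N} \<and> k \<in> {1..N} \<and> i < k}"
    by (rule finite_subset[of _ "{1..N} \<times> {1..N}"]) auto
  then have fin: "finite S" by (simp add: S_def)
  have "Min S \<in> S" using fin by (intro Min_in) (auto simp: S_def)
  then have "Min S > 0"
    using strict_mono_onD[OF assms] by (auto simp: S_def)
  moreover have "x i + Min S \<le> x k" if "i \<in> {1..N}" "k \<in> {1..N}" "i < k" for i k
  proof -
    have "x k - x i \<in> S" using that by (auto simp: S_def)
    then show ?thesis using Min_le[OF fin] by fastforce
  qed
  ultimately show ?thesis using that by blast
qed

text \<open>The root argument in abstract form, for any family with such a factorization and any
  error scale \<open>g\<close>. Its core is a bound of \<open>norm (Y j h - z h)\<close> by a
  constant times \<open>norm (F h (z h))\<close>.\<close>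

lemma ordered_root_bigo:
  fixes x :: "nat \<Rightarrow> real" and Y :: "nat \<Rightarrow> 'h \<Rightarrow> complex"
    and F :: "'h \<Rightarrow> complex \<Rightarrow> complex" and g :: "'h \<Rightarrow> complex"
  assumes factor: "eventually (\<lambda>h. \<forall>y. F h y = L * (\<Prod>i\<in>{1..N}. y - Y i h)) Fl" and L: "L \<noteq> 0"
    and mono: "eventually (\<lambda>h. mono_on {1..N} (\<lambda>i. Re (Y i h))) Fl"
    and x: "strict_mono_on {1..N} x"
    and lim: "\<And>i. i \<in> {1..N} \<Longrightarrow> ((\<lambda>h. F h (of_real (x i))) \<longlongrightarrow> 0) Fl"
    and j: "j \<in> {1..N}"
    and z: "(z \<longlongrightarrow> of_real (x j)) Fl"
    and Fz: "(\<lambda>h. F h (z h)) \<in> O[Fl](g)"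
  shows "(\<lambda>h. Y j h - z h) \<in> O[Fl](g)"
proof -
  obtain d' where d': "d' > 0"
    "\<And>i k. i \<in> {1..N} \<Longrightarrow> k \<in> {1..N} \<Longrightarrow> i < k \<Longrightarrow> x i + d' \<le> x k"
    using finite_strict_mono_gap[OF x] by blast
  \<comment> \<open>Of a gap \<open>3 * d\<close>, one \<open>d\<close> is spent on the distance
    from \<open>x i\<close> to its root and one on the distance from \<open>z h\<close> to
    \<open>x j\<close>; the third bounds the factor \<open>z h - Y i h\<close> from below.\<close>
  define d where "d = d' / 3"
  have d: "d > 0" and gap3: "\<And>i k. i \<in> {1..N} \<Longrightarrow> k \<in> {1..N} \<Longrightarrow> i < k \<Longrightarrow> x i + 3 * d \<le> x k"
    using d' by (auto simp: d_def)
  have gap: "x i + 2 * d \<le> x k" if "i \<in> {1..N}" "k \<in> {1..N}" "i < k" for i k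
    using gap3[OF that] d by linarith
  \<comment> \<open>Below this threshold the product of the \<open>N\<close> distances is less than
    \<open>d ^ N\<close>, so one of them is less than \<open>d\<close>.\<close>
  have "eventually (\<lambda>h. \<forall>i\<in>{1..N}. norm (F h (of_real (x i))) < norm L * d ^ N) Fl"
  proof (intro eventually_ball_finite ballI)
    fix i assume "i \<in> {1..N}"
    from tendsto_norm[OF lim[OF this]] show "eventually (\<lambda>h. norm (F h (of_real (x i))) < norm L * d ^ N) Fl"
      using L d by (intro order_tendstoD(2)) auto
  qed simp
  moreover have "eventually (\<lambda>h. dist (z h) (of_real (x j)) < d) Fl"
    using z d by (rule tendstoD)
  \<comment> \<open>The constant comes from the \<open>N - 1\<close> factors other than the
    \<open>j\<close>-th, each of norm at least \<open>d\<close>.\<close>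
  ultimately have "eventually (\<lambda>h. norm (Y j h - z h) \<le> 1 / (norm L * d ^ (N - 1)) * norm (F h (z h))) Fl"
    using factor mono
  proof eventually_elim
    case (elim h)
    have near: "\<exists>i\<in>{1..N}. norm (of_real (x k) - Y i h) < d" if "k \<in> {1..N}" for k
    proof (rule prod_less_power_imp_ex_less)
      have "norm L * (\<Prod>i\<in>{1..N}. norm (of_real (x k) - Y i h)) < norm L * d ^ N"
        using elim(1,3) that by (simp add: norm_mult prod_norm)
      then show "(\<Prod>i\<in>{1..N}. norm (of_real (x k) - Y i h)) < d ^ card {1..N}"
        using L by simp
    qed (use d in simp)
    have close: "norm (of_real (x k) - Y k h) < d" if "k \<in> {1..N}" for k
      using gap elim(4) near that by (rule ordered_points_close)
    have far: "d \<le> norm (z h - Y i h)" if "i \<in> {1..N} - {j}" for i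
    proof -
      have "3 * d \<le> \<bar>x i - x j\<bar>"
        using gap3[of i j] gap3[of j i] that j by (cases "i < j") auto
      also have "\<dots> = norm (complex_of_real (x i) - of_real (x j))"
        by (metis norm_of_real of_real_diff)
      also have "\<dots> = norm ((of_real (x i) - Y i h) - (z h - Y i h) + (z h - of_real (x j)))"
        by simp
      also have "\<dots> \<le> norm (of_real (x i) - Y i h) + norm (z h - Y i h) + norm (z h - of_real (x j))"
        by (intro order_trans[OF norm_triangle_ineq] add_right_mono norm_triangle_ineq4)
      finally show ?thesis using close[of i] elim(2) that by (auto simp: dist_norm)
    qed
    have "norm (Y j h - z h) * d ^ (N - 1) = norm (z h - Y j h) * (\<Prod>i\<in>{1..N} - {j}. d)"
      using j by (simp add: norm_minus_commute)
    also have "\<dots> \<le> norm (z h - Y j h) * (\<Prod>i\<in>{1..N} - {j}. norm (z h - Y i h))"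
      using far d by (intro mult_left_mono prod_mono) auto
    also have "\<dots> = (\<Prod>i\<in>{1..N}. norm (z h - Y i h))"
      using j by (subst (2) prod.remove[of _ j]) auto
    also have "\<dots> = norm (F h (z h)) / norm L"
      using elim(3) L by (simp add: norm_mult prod_norm)
    finally show ?case using L d by (simp add: field_simps)
  qed
  then have "(\<lambda>h. Y j h - z h) \<in> O[Fl](\<lambda>h. F h (z h))"
    by (rule bigoI)
  then show ?thesis using Fz by (rule landau_o.big_trans)
qed

section \<open>The rescaled difference polynomial\<close>

text \<open>\<open>\<epsilon>\<close> stands for \<open>1 / h\<close> but is a free complex
  variable, so that the limit case \<open>\<epsilon> = 0\<close> is a legitimate argument.\<close>

definition F :: "nat \<Rightarrow> complex \<Rightarrow> complex \<Rightarrow> (nat \<Rightarrow> complex) \<Rightarrow> real \<Rightarrow> complex \<Rightarrow> complex \<Rightarrow> complex" where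
  "F n a b c \<theta> \<epsilon> y = Q n \<theta> y + a * \<epsilon> * Q (n - 1) \<theta> y + b * \<epsilon>\<^sup>2 * Q (n - 2) \<theta> y
     + (\<Sum>k<n - 2. c k * \<epsilon> ^ (n - k) * Q k \<theta> y)"

text \<open>Homogeneity: \<open>(h * y + \<i> * h) ^ k = h ^ k * (y + \<i>) ^ k\<close>, and
  likewise with \<open>- \<i>\<close>. So a term of degree \<open>k\<close> in the polynomial
  contributes a multiple of \<open>h ^ k * Q k \<theta> y\<close>, and
  \<open>h ^ k = h ^ n * \<epsilon> ^ (n - k)\<close>.\<close>

lemma poly_D_poly_scaled:
  assumes "n \<ge> 2" and "h > 0"
  shows "poly (D_poly (P_poly n a b c) \<theta> h) (of_real h * y) =
    of_real h ^ n * F n a b c \<theta> (1 / of_real h) y"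
proof -
  define H where "H = complex_of_real h"
  have H: "H \<noteq> 0" using assms by (simp add: H_def)
  have pw: "H ^ n * (1 / H) ^ (n - k) = H ^ k" if "k \<le> n" for k
  proof -
    have "H ^ n = H ^ k * H ^ (n - k)" using that by (simp flip: power_add)
    then show ?thesis using H by (simp add: power_one_over)
  qed
  have pw': "H ^ n * (m * (1 / H) ^ (n - k) * q) = H ^ k * (m * q)" if "k \<le> n" for k m q
    using pw[OF that] by (metis mult.assoc mult.left_commute)
  have p1: "H ^ n * (a * (1 / H) * q) = H ^ (n - 1) * (a * q)" for q
    using pw'[of "n - 1" a q] assms(1) by simp
  have p2: "H ^ n * (b * (1 / H)\<^sup>2 * q) = H ^ (n - 2) * (b * q)" for q
    using pw'[of "n - 2" b q] assms(1) by simp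
  have scaled: "H ^ n * F n a b c \<theta> (1 / H) y =
    H ^ n * Q n \<theta> y + H ^ (n - 1) * (a * Q (n - 1) \<theta> y) + H ^ (n - 2) * (b * Q (n - 2) \<theta> y)
      + (\<Sum>k<n - 2. H ^ k * (c k * Q k \<theta> y))"
    unfolding F_def distrib_left sum_distrib_left p1 p2 by (simp add: pw')
  have "(H * y + \<i> * H) ^ k = H ^ k * (y + \<i>) ^ k"
    "(H * y - \<i> * H) ^ k = H ^ k * (y - \<i>) ^ k" for k
    by (simp_all add: algebra_simps flip: power_mult_distrib)
  then have "poly (P_poly n a b c) (H * y + \<i> * H) = H ^ n * (y + \<i>) ^ n + H ^ (n - 1) * (a * (y + \<i>) ^ (n - 1))
      + H ^ (n - 2) * (b * (y + \<i>) ^ (n - 2)) + (\<Sum>k<n - 2. H ^ k * (c k * (y + \<i>) ^ k))"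
    "poly (P_poly n a b c) (H * y - \<i> * H) = H ^ n * (y - \<i>) ^ n + H ^ (n - 1) * (a * (y - \<i>) ^ (n - 1))
      + H ^ (n - 2) * (b * (y - \<i>) ^ (n - 2)) + (\<Sum>k<n - 2. H ^ k * (c k * (y - \<i>) ^ k))"
    by (simp_all add: P_poly_def poly_monom poly_sum mult_ac)
  moreover have "(\<Sum>k<n - 2. H ^ k * (c k * Q k \<theta> y)) =
    (exp (\<i> * of_real \<theta>) * (\<Sum>k<n - 2. H ^ k * (c k * (y + \<i>) ^ k))
      - exp (- (\<i> * of_real \<theta>)) * (\<Sum>k<n - 2. H ^ k * (c k * (y - \<i>) ^ k))) / \<i>"
    unfolding sum_distrib_left sum_subtractf[symmetric] sum_divide_distrib
    by (intro sum.cong) (simp_all add: Q_def algebra_simps)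
  ultimately show ?thesis
    unfolding poly_D_poly H_def[symmetric] scaled by (simp add: Q_def) (simp add: algebra_simps)
qed

section \<open>Taylor expansion around a zero of \<open>Q n\<close>\<close>

text \<open>The remainder is kept as \<open>u ^ 3\<close> times a polynomial in \<open>u\<close>:
  later identities stay exact and continuity is immediate. The truncated exponents for small
  \<open>k\<close> do no harm, since their coefficients vanish.\<close>

lemma power_add_taylor2:
  fixes z :: "'a :: comm_ring_1"
  shows "\<exists>r. \<forall>u. (z + u) ^ k = z ^ k + of_nat k * z ^ (k - 1) * u
    + of_nat (k choose 2) * z ^ (k - 2) * u\<^sup>2 + u ^ 3 * poly r u"
proof (induction k)
  case 0
  show ?case by (rule exI[of _ 0]) (simp add: binomial_eq_0)
next
  case (Suc k)
  then obtain r where r: "\<And>u. (z + u) ^ k = z ^ k + of_nat k * z ^ (k - 1) * u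
    + of_nat (k choose 2) * z ^ (k - 2) * u\<^sup>2 + u ^ 3 * poly r u" by blast
  have 1: "of_nat k * z ^ (k - 1) * z = of_nat k * z ^ k"
    by (cases k) (simp_all add: algebra_simps)
  have 2: "of_nat (k choose 2) * z ^ (k - 2) * z = of_nat (k choose 2) * z ^ (k - 1)"
  proof (cases "k < 2")
    case True
    then have "k choose 2 = 0" by simp
    then show ?thesis by (simp only: of_nat_0 mult_zero_left)
  next
    case False
    then obtain m where "k = m + 2" by (metis add.commute le_Suc_ex not_less)
    then show ?thesis by (simp add: algebra_simps)
  qed
  have 3: "Suc k choose 2 = k + (k choose 2)"
    by (simp add: numeral_2_eq_2)
  show ?case
  proof (intro exI allI)
    fix u
    let ?C = "of_nat (k choose 2) :: 'a"
    \<comment> \<open>The new cubic remainder collects \<open>u\<close> times the old quadratic term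
      and \<open>z + u\<close> times the old remainder.\<close>
    have "(z + u) ^ Suc k = z ^ k * z + (of_nat k * z ^ (k - 1) * z) * u + z ^ k * u
        + (?C * z ^ (k - 2) * z) * u\<^sup>2 + of_nat k * z ^ (k - 1) * u\<^sup>2
        + u ^ 3 * (?C * z ^ (k - 2) + (z + u) * poly r u)"
      unfolding power_Suc r by (simp add: algebra_simps power2_eq_square power3_eq_cube)
    also have "\<dots> = z ^ Suc k + of_nat (Suc k) * z ^ (Suc k - 1) * u
        + of_nat (Suc k choose 2) * z ^ (Suc k - 2) * u\<^sup>2
        + u ^ 3 * poly ([:?C * z ^ (k - 2):] + [:z, 1:] * r) u"
      unfolding 1 2 3 by (simp add: algebra_simps eval_nat_numeral)
    finally show "(z + u) ^ Suc k = \<dots>" .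
  qed
qed

text \<open>The derivative of \<open>Q k\<close> is \<open>k\<close> times \<open>Q (k - 1)\<close>,
  so the Taylor coefficients are again values of \<open>Q\<close>.\<close>

lemma Q_taylor2:
  "\<exists>r. \<forall>u. Q k \<theta> (y + u) = Q k \<theta> y + of_nat k * Q (k - 1) \<theta> y * u
    + of_nat (k choose 2) * Q (k - 2) \<theta> y * u\<^sup>2 + u ^ 3 * poly r u"
proof -
  obtain r s where rs: "\<And>u. (y + \<i> + u) ^ k = (y + \<i>) ^ k + of_nat k * (y + \<i>) ^ (k - 1) * u
      + of_nat (k choose 2) * (y + \<i>) ^ (k - 2) * u\<^sup>2 + u ^ 3 * poly r u"
    "\<And>u. (y - \<i> + u) ^ k = (y - \<i>) ^ k + of_nat k * (y - \<i>) ^ (k - 1) * u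
      + of_nat (k choose 2) * (y - \<i>) ^ (k - 2) * u\<^sup>2 + u ^ 3 * poly s u"
    using power_add_taylor2[of "y + \<i>" k] power_add_taylor2[of "y - \<i>" k] by blast
  define r' where "r' = smult (1 / \<i>) (smult (exp (\<i> * of_real \<theta>)) r - smult (exp (- (\<i> * of_real \<theta>))) s)"
  have "Q k \<theta> (y + u) = Q k \<theta> y + of_nat k * Q (k - 1) \<theta> y * u
    + of_nat (k choose 2) * Q (k - 2) \<theta> y * u\<^sup>2 + u ^ 3 * poly r' u" for u
  proof -
    have "y + u + \<i> = y + \<i> + u" "y + u - \<i> = y - \<i> + u" by simp_all
    then show ?thesis
      by (simp only: Q_def rs) (simp add: r'_def algebra_simps)
  qed
  then show ?thesis by blast
qed

lemma isCont_Q [continuous_intros]: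
  "isCont f x \<Longrightarrow> isCont (\<lambda>x. Q k \<theta> (f x)) x"
  unfolding Q_def by (intro continuous_intros)

text \<open>This is simplicity of the zeros of \<open>Q n\<close>, and it justifies the division by
  \<open>Q (n - 1)\<close>. A common zero would give \<open>w * (y + \<i>) = w * (y - \<i>)\<close>,
  hence \<open>w = 0\<close>, and then both \<open>y = - \<i>\<close> and
  \<open>y = \<i>\<close>.\<close>

lemma Q_neq_0:
  assumes "Q n \<theta> y = 0" and "n \<ge> 2"
  shows "Q (n - 1) \<theta> y \<noteq> 0"
proof
  assume 0: "Q (n - 1) \<theta> y = 0"
  obtain m where m: "n = Suc m" "m > 0" using assms(2) by (cases n) auto
  define w where "w = exp (\<i> * of_real \<theta>) * (y + \<i>) ^ m"
  have w: "w = exp (- (\<i> * of_real \<theta>)) * (y - \<i>) ^ m"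
    using 0 m by (simp add: Q_def w_def)
  have "w * (y + \<i>) = exp (- (\<i> * of_real \<theta>)) * (y - \<i>) ^ m * (y - \<i>)"
    using assms(1) m by (simp add: Q_def w_def mult_ac)
  then have "w * (2 * \<i>) = 0"
    unfolding w[symmetric] by (simp add: algebra_simps)
  then have "w = 0" by simp
  then have "y + \<i> = 0" "y - \<i> = 0"
    by (simp add: w_def) (use \<open>w = 0\<close> w in simp)
  then have "(y + \<i>) - (y - \<i>) = 0" by simp
  then show False by simp
qed

text \<open>\<open>\<alpha>\<close> and \<open>\<beta>\<close> are the values that cancel the
  coefficients of \<open>\<epsilon>\<close> and \<open>\<epsilon>\<^sup>2\<close>. Continuity of
  \<open>G\<close> at 0 turns the exact identity into a bound of order
  \<open>\<epsilon> ^ 3\<close>.\<close>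

lemma F_expansion:
  fixes a b y :: complex
  assumes n: "n \<ge> 2" and y: "Q n \<theta> y = 0"
  defines "\<alpha> \<equiv> - a / of_nat n"
    and "\<beta> \<equiv> (a ^ 2 * (of_nat n - 1) / (2 * of_nat n ^ 2) - b / of_nat n)
               * (Q (n - 2) \<theta> y / Q (n - 1) \<theta> y)"
  shows "\<exists>G. isCont G 0 \<and> (\<forall>\<epsilon>. F n a b c \<theta> \<epsilon> (y + (\<alpha> * \<epsilon> + \<beta> * \<epsilon>\<^sup>2)) = \<epsilon> ^ 3 * G \<epsilon>)"
proof -
  obtain r s t where r: "\<And>u. Q n \<theta> (y + u) = Q n \<theta> y + of_nat n * Q (n - 1) \<theta> y * u
    + of_nat (n choose 2) * Q (n - 2) \<theta> y * u\<^sup>2 + u ^ 3 * poly r u"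
   and s: "\<And>u. Q (n - 1) \<theta> (y + u) = Q (n - 1) \<theta> y + of_nat (n - 1) * Q (n - 1 - 1) \<theta> y * u
    + of_nat (n - 1 choose 2) * Q (n - 1 - 2) \<theta> y * u\<^sup>2 + u ^ 3 * poly s u"
   and t: "\<And>u. Q (n - 2) \<theta> (y + u) = Q (n - 2) \<theta> y + of_nat (n - 2) * Q (n - 2 - 1) \<theta> y * u
    + of_nat (n - 2 choose 2) * Q (n - 2 - 2) \<theta> y * u\<^sup>2 + u ^ 3 * poly t u"
    using Q_taylor2[of n \<theta> y] Q_taylor2[of "n - 1" \<theta> y] Q_taylor2[of "n - 2" \<theta> y] by blast
  define q1 q2 where "q1 = Q (n - 1) \<theta> y" and "q2 = Q (n - 2) \<theta> y"
  define K where "K = (of_nat n :: complex)"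
  have K: "K \<noteq> 0" "K = of_nat n" "of_nat (n - 1) = K - 1" "of_nat (n choose 2) = K * (K - 1) / 2"
    using n by (auto simp: K_def binomial_gbinomial gbinomial_prod_rev numeral_2_eq_2 of_nat_diff)
  have q1: "q1 \<noteq> 0" using Q_neq_0[OF y n] by (simp add: q1_def)
  define C where "C = K * (K - 1) / 2"
  define S1 where "S1 = of_nat (n - 1 choose 2) * Q (n - 1 - 2) \<theta> y"
  define T1 where "T1 = of_nat (n - 2) * Q (n - 2 - 1) \<theta> y"
  define T2 where "T2 = of_nat (n - 2 choose 2) * Q (n - 2 - 2) \<theta> y"
  define v where "v = (\<lambda>\<epsilon>. \<alpha> + \<beta> * \<epsilon>)"
  \<comment> \<open>Everything of order at least 3, with \<open>\<epsilon> ^ 3\<close> already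
    divided out by hand so that \<open>\<epsilon> = 0\<close> is covered: the rest of the quadratic
    term of \<open>Q n\<close>, the higher Taylor terms, and the tail, where
    \<open>k < n - 2\<close> makes \<open>n - 3 - k\<close> a true difference.\<close>
  define G where "G = (\<lambda>\<epsilon>.
      C * q2 * (2 * \<alpha> * \<beta> + \<beta>\<^sup>2 * \<epsilon>) + v \<epsilon> ^ 3 * poly r (\<epsilon> * v \<epsilon>)
      + a * ((K - 1) * q2 * \<beta> + S1 * (v \<epsilon>)\<^sup>2 + \<epsilon> * v \<epsilon> ^ 3 * poly s (\<epsilon> * v \<epsilon>))
      + b * (T1 * v \<epsilon> + T2 * \<epsilon> * (v \<epsilon>)\<^sup>2 + \<epsilon>\<^sup>2 * v \<epsilon> ^ 3 * poly t (\<epsilon> * v \<epsilon>))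
      + (\<Sum>k<n - 2. c k * \<epsilon> ^ (n - 3 - k) * Q k \<theta> (y + \<epsilon> * v \<epsilon>)))"
  have "isCont G 0"
    unfolding G_def v_def by (intro continuous_intros)
  moreover have "F n a b c \<theta> \<epsilon> (y + (\<alpha> * \<epsilon> + \<beta> * \<epsilon>\<^sup>2)) = \<epsilon> ^ 3 * G \<epsilon>" for \<epsilon>
  proof -
    have u: "\<alpha> * \<epsilon> + \<beta> * \<epsilon>\<^sup>2 = \<epsilon> * v \<epsilon>"
      by (simp add: v_def algebra_simps power2_eq_square)
    have sum: "(\<Sum>k<n - 2. c k * \<epsilon> ^ (n - k) * Q k \<theta> (y + \<epsilon> * v \<epsilon>))
      = \<epsilon> ^ 3 * (\<Sum>k<n - 2. c k * \<epsilon> ^ (n - 3 - k) * Q k \<theta> (y + \<epsilon> * v \<epsilon>))"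
      unfolding sum_distrib_left
    proof (rule sum.cong)
      fix k assume "k \<in> {..<n - 2}"
      then have "n - k = 3 + (n - 3 - k)" by auto
      then have "\<epsilon> ^ (n - k) = \<epsilon> ^ 3 * \<epsilon> ^ (n - 3 - k)" by (metis power_add)
      then show "c k * \<epsilon> ^ (n - k) * Q k \<theta> (y + \<epsilon> * v \<epsilon>)
        = \<epsilon> ^ 3 * (c k * \<epsilon> ^ (n - 3 - k) * Q k \<theta> (y + \<epsilon> * v \<epsilon>))" by simp
    qed simp
    \<comment> \<open>\<open>e1\<close> and \<open>e2\<close> are the equations for the orders 1 and
      2; solving \<open>e2\<close> for \<open>\<beta>\<close> needs
      \<open>q1 \<noteq> 0\<close>.\<close>
    have e1: "K * \<alpha> + a = 0" using K by (simp add: \<alpha>_def)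
    have e2: "K * q1 * \<beta> + C * q2 * \<alpha>\<^sup>2 + a * ((K - 1) * q2 * \<alpha>) + b * q2 = 0"
      using K(1) q1 unfolding C_def \<alpha>_def \<beta>_def K(2)[symmetric] q1_def[symmetric] q2_def[symmetric]
      by (simp add: field_simps power2_eq_square)
    have n2: "n - 1 - 1 = n - 2" by simp
    define R where "R = (\<Sum>k<n - 2. c k * \<epsilon> ^ (n - 3 - k) * Q k \<theta> (y + \<epsilon> * v \<epsilon>))"
    have v: "v \<epsilon> - \<epsilon> * \<beta> = \<alpha>" "(v \<epsilon>)\<^sup>2 - \<epsilon> * (2 * \<alpha> * \<beta> + \<beta>\<^sup>2 * \<epsilon>) = \<alpha>\<^sup>2"
      by (simp_all add: v_def algebra_simps power2_eq_square)
    \<comment> \<open>Here \<open>v \<epsilon>\<close> stays opaque, so the higher terms cancel by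
      ring arithmetic; unfolding it afterwards sorts the remainder by powers of
      \<open>\<epsilon>\<close>.\<close>
    have "F n a b c \<theta> \<epsilon> (y + \<epsilon> * v \<epsilon>) - \<epsilon> ^ 3 * G \<epsilon> = \<epsilon> * (K * q1 * v \<epsilon> + a * q1)
      + \<epsilon>\<^sup>2 * (C * q2 * ((v \<epsilon>)\<^sup>2 - \<epsilon> * (2 * \<alpha> * \<beta> + \<beta>\<^sup>2 * \<epsilon>))
        + a * ((K - 1) * q2 * (v \<epsilon> - \<epsilon> * \<beta>)) + b * q2)"
      unfolding F_def sum r s t G_def y n2 K(3,4) C_def[symmetric] R_def[symmetric] K(2)[symmetric]
        q1_def[symmetric] q2_def[symmetric] S1_def[symmetric] T1_def[symmetric] T2_def[symmetric]
      by (simp add: algebra_simps power2_eq_square power3_eq_cube)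
    also have "\<dots> = \<epsilon> * (K * \<alpha> + a) * q1
      + \<epsilon>\<^sup>2 * (K * q1 * \<beta> + C * q2 * \<alpha>\<^sup>2 + a * ((K - 1) * q2 * \<alpha>) + b * q2)"
      unfolding v by (simp add: v_def algebra_simps power2_eq_square)
    finally have "F n a b c \<theta> \<epsilon> (y + \<epsilon> * v \<epsilon>) - \<epsilon> ^ 3 * G \<epsilon> = 0"
      unfolding e1 e2 by simp
    then show ?thesis unfolding u by simp
  qed
  ultimately show ?thesis by blast
qed

section \<open>Leading coefficient of \<open>D_poly\<close> and factorization over its roots\<close>

lemma coeff_pcompose_shift:
  fixes p :: "'a :: comm_ring_1 poly"
  assumes "degree p \<le> n"
  shows "coeff (pcompose p [:d, 1:]) m = (\<Sum>k\<le>n. coeff p k * (of_nat (k choose m) * d ^ (k - m)))"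
proof -
  have pw: "coeff ([:d, 1:] ^ k) m = of_nat (k choose m) * d ^ (k - m)" for k
  proof (cases "m \<le> k")
    case False
    then have "degree ([:d, 1:] ^ k) < m"
      by (simp add: degree_linear_power)
    then show ?thesis using False by (simp add: coeff_eq_0 binomial_eq_0)
  qed (simp add: coeff_linear_poly_power)
  have mono: "pcompose (monom e k) [:d, 1:] = smult e ([:d, 1:] ^ k)" for e k
    by (induction k) (simp_all add: monom_0 monom_Suc pcompose_pCons)
  have "pcompose p [:d, 1:] = (\<Sum>k\<le>n. smult (coeff p k) ([:d, 1:] ^ k))"
    using poly_as_sum_of_monoms'[OF assms] by (metis (no_types, lifting) mono pcompose_sum sum.cong)
  then show ?thesis by (simp add: coeff_sum pw)
qed

lemma coeff_pcompose_shift_top: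
  fixes p :: "'a :: comm_ring_1 poly"
  assumes "degree p \<le> n"
  shows "coeff (pcompose p [:d, 1:]) n = coeff p n"
proof -
  have "coeff p k * (of_nat (k choose n) * d ^ (k - n)) = (if k = n then coeff p n else 0)"
    if "k \<in> {..n}" for k
    using that by (auto simp: binomial_eq_0)
  then show ?thesis by (simp add: coeff_pcompose_shift[OF assms])
qed

lemma coeff_pcompose_shift_second:
  fixes p :: "'a :: comm_ring_1 poly"
  assumes "degree p \<le> Suc n"
  shows "coeff (pcompose p [:d, 1:]) n = coeff p n + of_nat (Suc n) * d * coeff p (Suc n)"
proof -
  have "coeff p k * (of_nat (k choose n) * d ^ (k - n)) = (if k = n then coeff p n else 0)"
    if "k \<in> {..n}" for k
    using that by (auto simp: binomial_eq_0)
  then show ?thesis by (simp add: coeff_pcompose_shift[OF assms] mult_ac)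
qed

lemma degree_P_poly: "degree (P_poly n a b c) \<le> n"
  unfolding P_poly_def
  by (intro degree_add_le degree_sum_le) (auto intro!: order_trans[OF degree_monom_le])

lemma coeff_P_poly: "n \<ge> 2 \<Longrightarrow> coeff (P_poly n a b c) n = 1"
  by (auto simp: P_poly_def coeff_sum intro!: sum.neutral)

text \<open>For \<open>sin \<theta> = 0\<close> the coefficients of degree \<open>n\<close> cancel.
  One degree lower \<open>a\<close> cancels too, and the shifts by \<open>\<i> * h\<close> and
  \<open>- \<i> * h\<close> leave \<open>2 * n * \<i> * h\<close>; hence the factor
  \<open>h ^ (n - N)\<close>.\<close>

lemma coeff_D_poly:
  assumes "n \<ge> 2" and "N = (if sin \<theta> \<noteq> 0 then n else n - 1)"
  shows "coeff (D_poly (P_poly n a b c) \<theta> h) N =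
    of_real h ^ (n - N) * (if sin \<theta> \<noteq> 0 then 2 * of_real (sin \<theta>) else 2 * of_nat n * of_real (cos \<theta>))"
proof -
  have e: "exp (\<i> * of_real \<theta>) = of_real (cos \<theta>) + \<i> * of_real (sin \<theta>)"
    "exp (- (\<i> * of_real \<theta>)) = of_real (cos \<theta>) - \<i> * of_real (sin \<theta>)"
    using exp_Euler[of "of_real \<theta>"] exp_Euler[of "- of_real \<theta>"]
    by (simp_all add: cos_of_real sin_of_real)
  show ?thesis
  proof (cases "sin \<theta> = 0")
    case True
    obtain m where m: "n = Suc m" using assms(1) by (cases n) auto
    show ?thesis
      using True assms degree_P_poly[of n a b c] coeff_P_poly[OF assms(1), of a b c]
      by (simp add: D_poly_def e m coeff_pcompose_shift_second algebra_simps)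
  next
    case False
    then show ?thesis
      using assms coeff_P_poly[OF assms(1), of a b c]
      by (simp add: D_poly_def e coeff_pcompose_shift_top[OF degree_P_poly] algebra_simps)
  qed
qed

lemma F_factorization:
  assumes n: "n \<ge> 2" and N: "N = (if sin \<theta> \<noteq> 0 then n else n - 1)" and h: "h > 0"
    and X: "image_mset X (mset_set {1..N}) = proots (D_poly (P_poly n a b c) \<theta> h)"
  shows "F n a b c \<theta> (1 / of_real h) y =
    (if sin \<theta> \<noteq> 0 then 2 * of_real (sin \<theta>) else 2 * of_nat n * of_real (cos \<theta>))
      * (\<Prod>i\<in>{1..N}. y - X i / of_real h)"
    (is "_ = ?L * _")
proof -
  define p where "p = D_poly (P_poly n a b c) \<theta> h"
  \<comment> \<open>The degree is read off from the number of roots: over the complex numbers the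
    two agree, counting multiplicity.\<close>
  have "degree p = size (image_mset X (mset_set {1..N}))"
    by (simp only: X p_def size_proots_complex)
  then have deg: "degree p = N" by simp
  have "p = smult (lead_coeff p) (\<Prod>r\<in>#image_mset X (mset_set {1..N}). [:- r, 1:])"
    using complex_poly_decompose_multiset[of p] X by (simp add: p_def)
  also have "\<dots> = smult (coeff p N) (\<Prod>i\<in>{1..N}. [:- X i, 1:])"
    by (simp add: deg prod_unfold_prod_mset image_mset.compositionality o_def)
  finally have "poly p (of_real h * y) = poly (smult (coeff p N) (\<Prod>i\<in>{1..N}. [:- X i, 1:])) (of_real h * y)"
    by (rule arg_cong)
  then have "poly p (of_real h * y) = coeff p N * (\<Prod>i\<in>{1..N}. of_real h * y - X i)"
    by (simp add: poly_prod)
  also have "(\<Prod>i\<in>{1..N}. of_real h * y - X i) = (\<Prod>i\<in>{1..N}. of_real h * (y - X i / of_real h))"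
    using h by (intro prod.cong) (auto simp: field_simps)
  also have "\<dots> = of_real h ^ N * (\<Prod>i\<in>{1..N}. y - X i / of_real h)"
    by (simp add: prod.distrib)
  also have "coeff p N = of_real h ^ (n - N) * ?L"
    unfolding p_def by (rule coeff_D_poly[OF n N])
  finally have "of_real h ^ n * F n a b c \<theta> (1 / of_real h) y =
    (of_real h ^ (n - N) * of_real h ^ N) * (?L * (\<Prod>i\<in>{1..N}. y - X i / of_real h))"
    using poly_D_poly_scaled[OF n h, of a b c \<theta> y] by (simp add: p_def mult_ac)
  \<comment> \<open>The leading coefficient supplies \<open>h ^ (n - N)\<close> and the
    \<open>N\<close> linear factors supply \<open>h ^ N\<close>, which together match the scaling
    factor \<open>h ^ n\<close>.\<close>
  also have "complex_of_real h ^ (n - N) * of_real h ^ N = of_real h ^ n"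
    using N by (simp flip: power_add)
  finally show ?thesis using h by simp
qed

section \<open>Asymptotics of the rescaled roots and return to the original scale\<close>

theorem theorem1p7:
  fixes n N j :: nat and a b :: complex and c :: "nat \<Rightarrow> complex" and \<theta> :: real
    and X :: "nat \<Rightarrow> real \<Rightarrow> complex" and x :: "nat \<Rightarrow> real"
  assumes "n \<ge> 2"
    and "N = (if sin \<theta> \<noteq> 0 then n else n - 1)"
    and "\<And>h. h > 0 \<Longrightarrow>
           image_mset (\<lambda>i. X i h) (mset_set {1..N}) = proots (D_poly (P_poly n a b c) \<theta> h)"
    and "\<And>h. h > 0 \<Longrightarrow> mono_on {1..N} (\<lambda>i. Re (X i h))"
    and "strict_mono_on {1..N} x"
    and "x ` {1..N} = {t. Q n \<theta> (of_real t) = 0}"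
    and "j \<in> {1..N}"
  shows "(\<lambda>h. X j h -
            (of_real (x j) * of_real h - a / of_nat n
             + (a ^ 2 * (of_nat n - 1) / (2 * of_nat n ^ 2) - b / of_nat n)
               * (Q (n - 2) \<theta> (of_real (x j)) / Q (n - 1) \<theta> (of_real (x j)))
               * (1 / of_real h)))
         \<in> O[at_top](\<lambda>h. 1 / of_real h ^ 2)"
proof -
  let ?y = "complex_of_real (x j)"
  define \<alpha> where "\<alpha> = - a / of_nat n"
  define \<beta> where "\<beta> = (a ^ 2 * (of_nat n - 1) / (2 * of_nat n ^ 2) - b / of_nat n)
               * (Q (n - 2) \<theta> ?y / Q (n - 1) \<theta> ?y)"
  define \<epsilon> where "\<epsilon> = (\<lambda>h. 1 / complex_of_real h)"
  define z where "z = (\<lambda>h. ?y + (\<alpha> * \<epsilon> h + \<beta> * (\<epsilon> h)\<^sup>2))"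
  define L :: complex where
    "L = (if sin \<theta> \<noteq> 0 then 2 * of_real (sin \<theta>) else 2 * of_nat n * of_real (cos \<theta>))"
  \<comment> \<open>If \<open>sin \<theta> = 0\<close>, then \<open>cos \<theta>\<close> has
    absolute value 1.\<close>
  have L: "L \<noteq> 0"
    using assms(1) sin_zero_abs_cos_one[of \<theta>] by (auto simp: L_def)
  have zero: "Q n \<theta> (of_real (x i)) = 0" if "i \<in> {1..N}" for i
    using assms(6) that by blast
  have \<epsilon>0: "(\<epsilon> \<longlongrightarrow> 0) at_top"
    using tendsto_of_real[OF tendsto_inverse_0_at_top[OF filterlim_ident], where 'a = complex]
    by (simp add: \<epsilon>_def divide_inverse)
  have pos: "eventually (\<lambda>h::real. h > 0) at_top" by (rule eventually_gt_at_top)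
  obtain G where G: "isCont G 0"
    "\<And>e. F n a b c \<theta> e (?y + (\<alpha> * e + \<beta> * e\<^sup>2)) = e ^ 3 * G e"
    using F_expansion[OF assms(1) zero[OF assms(7)]] unfolding \<alpha>_def \<beta>_def by blast
  have "(\<lambda>h. X j h / of_real h - z h) \<in> O[at_top](\<lambda>h. \<epsilon> h ^ 3)"
  proof (rule ordered_root_bigo)
    show "eventually (\<lambda>h. \<forall>y. F n a b c \<theta> (\<epsilon> h) y = L * (\<Prod>i\<in>{1..N}. y - X i h / of_real h)) at_top"
      using pos
    proof eventually_elim
      case (elim h)
      show ?case
        unfolding \<epsilon>_def L_def using F_factorization[OF assms(1,2) elim assms(3)[OF elim]] by blast
    qed
    show "eventually (\<lambda>h. mono_on {1..N} (\<lambda>i. Re (X i h / of_real h))) at_top"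
      using pos
    proof eventually_elim
      case (elim h)
      show ?case
        using mono_onD[OF assms(4)[OF elim]] elim by (intro mono_onI) (simp add: divide_right_mono)
    qed
    show "((\<lambda>h. F n a b c \<theta> (\<epsilon> h) (of_real (x i))) \<longlongrightarrow> 0) at_top" if "i \<in> {1..N}" for i
    proof -
      \<comment> \<open>\<open>F\<close> is polynomial in \<open>\<epsilon>\<close>; at
        \<open>\<epsilon> = 0\<close> only \<open>Q n\<close> survives, because every exponent
        \<open>n - k\<close> in the tail is positive.\<close>
      have "((\<lambda>h. F n a b c \<theta> (\<epsilon> h) (of_real (x i))) \<longlongrightarrow> F n a b c \<theta> 0 (of_real (x i))) at_top"
        unfolding F_def by (intro tendsto_intros \<epsilon>0)
      also have "F n a b c \<theta> 0 (of_real (x i)) = 0"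
        using zero[OF that] by (auto simp: F_def power_0_left intro!: sum.neutral)
      finally show ?thesis .
    qed
    have "(z \<longlongrightarrow> ?y + (\<alpha> * 0 + \<beta> * 0\<^sup>2)) at_top"
      unfolding z_def by (intro tendsto_intros \<epsilon>0)
    then show "(z \<longlongrightarrow> ?y) at_top" by simp
    have "((\<lambda>h. G (\<epsilon> h)) \<longlongrightarrow> G 0) at_top"
      using G(1) \<epsilon>0 by (rule isCont_tendsto_compose)
    then have "(\<lambda>h. G (\<epsilon> h)) \<in> O[at_top](\<lambda>_. 1)"
      by (intro bigoI_tendsto) auto
    then have "(\<lambda>h. \<epsilon> h ^ 3 * G (\<epsilon> h)) \<in> O[at_top](\<lambda>h. \<epsilon> h ^ 3 * 1)"
      by (intro landau_o.big.mult_left)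
    then show "(\<lambda>h. F n a b c \<theta> (\<epsilon> h) (z h)) \<in> O[at_top](\<lambda>h. \<epsilon> h ^ 3)"
      by (simp add: z_def G(2))
  qed (use L assms(5,7) in auto)
  \<comment> \<open>Undoing the scaling costs one factor \<open>h\<close>, which turns
    \<open>\<epsilon> ^ 3\<close> into \<open>1 / h ^ 2\<close>.\<close>
  then have "(\<lambda>h. of_real h * (X j h / of_real h - z h)) \<in> O[at_top](\<lambda>h. of_real h * \<epsilon> h ^ 3)"
    by (intro landau_o.big.mult_left)
  also have "(\<lambda>h. of_real h * \<epsilon> h ^ 3) \<in> \<Theta>[at_top](\<lambda>h. 1 / of_real h ^ 2)"
    using pos by (intro bigthetaI_cong, elim eventually_mono) (simp add: \<epsilon>_def field_simps eval_nat_numeral)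
  finally show ?thesis
  proof (rule landau_o.big.in_cong[THEN iffD1, rotated])
    show "eventually (\<lambda>h. of_real h * (X j h / of_real h - z h) = X j h -
            (of_real (x j) * of_real h - a / of_nat n
             + (a ^ 2 * (of_nat n - 1) / (2 * of_nat n ^ 2) - b / of_nat n)
               * (Q (n - 2) \<theta> (of_real (x j)) / Q (n - 1) \<theta> (of_real (x j)))
               * (1 / of_real h))) at_top"
      using pos
    proof eventually_elim
      case (elim h)
      have "of_real h * (X j h / of_real h - z h) = X j h - (?y * of_real h + \<alpha> + \<beta> * (1 / of_real h))"
        using elim by (simp add: z_def \<epsilon>_def field_simps power2_eq_square)
      then show ?case by (simp add: \<alpha>_def \<beta>_def)
    qed
  qed
qed

end
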